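(* Let $n\ge1$ and $K,L\in\mathcal{K}^n_0$. Then the following are equivalent: (i) For all $x\in\mathbb{R}^n\setminus\{0\}$, there exist parallel hyperplanes supporting $K$ at $\frac{x}{\|x\|_K}$ and $L$ at $\frac{x}{\|x\|_L}$. (ii) $n=1$, or $K$ and $L$ are dilates of each other.
   Context: $\mathcal{K}^n_0$ denotes the set of compact convex subsets of $\mathbb{R}^n$ containing the origin in their interior. For $C\in\mathcal{K}^n_0$, $\|x\|_C=\inf\{\lambda\ge0 : x\in\lambda C\}$ is the gauge function. A hyperplane $H$ supports a set $X$ at $x\in X$ if $x\in H$ and $X$ is contained in one of the closed halfspaces bounded by $H$. $K$ and $L$ are dilates of each other if $L=\lambda K$ for some $\lambda>0$. (In dimension $1$ hyperplanes are points.) *)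

theory Defs imports "HOL-Analysis.Analysis" begin

definition bodies0 :: "(real^'n) set set" where
  "bodies0 = {K. compact K \<and> convex K \<and> 0 \<in> interior K}"

(* Unrelated to the constant gauge of Henstock_Kurzweil_Integration. The infimum is over a nonempty
   set whenever 0 is in the interior of C. *)
definition gauge_fun :: "(real^'n) set \<Rightarrow> real^'n \<Rightarrow> real" where
  "gauge_fun C x = Inf {t. 0 \<le> t \<and> x \<in> (*\<^sub>R) t ` C}"

(* The closed halfspaces bounded by {y. a \<bullet> y = b} do not depend on the choice of a and b
   representing the hyperplane, up to exchanging the two. *)
definition supports_at :: "(real^'n) set \<Rightarrow> (real^'n) set \<Rightarrow> real^'n \<Rightarrow> bool" where
  "supports_at H X x \<longleftrightarrow> x \<in> X \<and> x \<in> H \<and>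
     (\<exists>a b. a \<noteq> 0 \<and> H = {y. a \<bullet> y = b} \<and> (X \<subseteq> {y. a \<bullet> y \<le> b} \<or> X \<subseteq> {y. a \<bullet> y \<ge> b}))"

definition dilates :: "(real^'n) set \<Rightarrow> (real^'n) set \<Rightarrow> bool" where
  "dilates K L \<longleftrightarrow> (\<exists>t>0. L = (*\<^sub>R) t ` K)"

end

theory Submission imports Defs begin

text \<open>
  Let \<open>f\<close> and \<open>g\<close> be the gauges of \<open>K\<close> and \<open>L\<close>. A hyperplane supporting \<open>K\<close> at \<open>x / f x\<close> misses
  the origin, so it has exactly one normal \<open>w\<close> with \<open>w \<bullet> x = 1\<close>, and the support condition says
  that \<open>f x * (w \<bullet> y) \<le> f y\<close> for all \<open>y\<close>: the vector \<open>f x *\<^sub>R w\<close> is a subgradient of \<open>f\<close> at \<open>x\<close>.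
  Two such hyperplanes are parallel exactly when their normalised normals agree. Hence the
  condition on parallel supports asks that \<open>f\<close> and \<open>g\<close> have, at every \<open>x \<noteq> 0\<close>, a common normalised subgradient
  (\<open>parallel_supports_iff_common_normal\<close>), which formally means that \<open>ln f\<close> and \<open>ln g\<close> have the
  same derivative. As dilates are the bodies with proportional gauges
  (\<open>dilates_iff_gauges_proportional\<close>), what must be shown is that \<open>g / f\<close> is then constant.

  Convex functions need not be differentiable, so the derivative argument is replaced by a
  discrete one. Restrict \<open>f\<close> and \<open>g\<close> to a segment that avoids the origin, with subderivatives
  \<open>p\<close> of \<open>f\<close> and \<open>(g / f) * p\<close> of \<open>g\<close>. The subgradient inequality for \<open>g\<close> at the left end of a
  short interval and the one for \<open>f\<close> at its right end bound the increment of \<open>g / f\<close> from below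
  by \<open>- C\<close> times the length of the interval times the increment of \<open>p\<close>. Because \<open>p\<close> is monotone,
  its increments telescope, and with \<open>N\<close> equal intervals the total loss is \<open>O(1 / N)\<close>. So
  \<open>g / f\<close> does not decrease along the segment (\<open>quotient_mono_if_proportional_subgradients\<close>), and
  traversing the segment backwards shows that it is constant there. In dimension at least two the
  complement of the origin is connected, so \<open>g / f\<close> is constant on it.

  Conversely, dilates have the same supporting directions, and on a line the vector
  \<open>x / (x \<bullet> x)\<close> is a normal for both bodies at once.
\<close>

section \<open>Convex functions of one variable with proportional subgradients\<close>

text \<open>
  Cutting \<open>[0, 1]\<close> into \<open>N\<close> equal intervals, the right-hand sides add up to
  \<open>- (p 1 - p 0) / N\<close>, which tends to \<open>0\<close>.
\<close>
lemma nondecreasing_if_increments_second_order: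
  fixes r p :: "real \<Rightarrow> real"
  assumes inc: "\<And>s t. 0 \<le> t \<Longrightarrow> t \<le> s \<Longrightarrow> s \<le> 1 \<Longrightarrow> r s - r t \<ge> - ((s - t) * (p s - p t))"
  shows "r 0 \<le> r 1"
proof (rule ccontr)
  assume "\<not> r 0 \<le> r 1"
  then have pos: "0 < r 0 - r 1" by simp
  obtain n :: nat where n: "p 1 - p 0 < real n * (r 0 - r 1)"
    using ex_less_of_nat_mult[OF pos] by blast
  define N where "N = Suc n"
  have N: "0 < real N" by (simp add: N_def)
  have telescope: "r (i / N) - r 0 \<ge> - ((p (i / N) - p 0) / N)" if "i \<le> N" for i :: nat
    using that
  proof (induction i)
    case (Suc i)
    have "r (Suc i / N) - r (i / N)
        \<ge> - ((Suc i / N - i / N) * (p (Suc i / N) - p (i / N)))"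
      using Suc.prems N by (intro inc) (auto simp: divide_right_mono)
    moreover have "real (Suc i) / N - i / N = 1 / N"
      by (simp add: diff_divide_distrib[symmetric])
    ultimately show ?case
      using Suc.IH Suc.prems by (simp add: diff_divide_distrib)
  qed simp
  have "real N * (r 0 - r 1) \<le> p 1 - p 0"
    using telescope[of N] N by (simp add: field_simps)
  moreover have "real n * (r 0 - r 1) \<le> real N * (r 0 - r 1)"
    using pos by (intro mult_right_mono) (auto simp: N_def)
  ultimately show False using n by linarith
qed

lemma subgradient_mono:
  fixes f p :: "real \<Rightarrow> real"
  assumes "f t + p t * (s - t) \<le> f s" and "f s + p s * (t - s) \<le> f t" and "t \<le> s"
  shows "p t \<le> p s"
proof (rule ccontr)
  assume "\<not> p t \<le> p s"
  moreover from this have "t \<noteq> s" by auto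
  ultimately have "(p t - p s) * (s - t) > 0" using assms(3) by simp
  then show False using assms(1,2) by (simp add: algebra_simps)
qed

text \<open>
  The subgradients are monotone, hence lie between those at \<open>0\<close> and \<open>1\<close>; a common bound for them
  is a Lipschitz constant.
\<close>
lemma continuous_on_if_subgradient:
  fixes f p :: "real \<Rightarrow> real"
  assumes sub: "\<And>s t. s \<in> {0..1} \<Longrightarrow> t \<in> {0..1} \<Longrightarrow> f t + p t * (s - t) \<le> f s"
  shows "continuous_on {0..1} f"
proof -
  define B where "B = \<bar>p 0\<bar> + \<bar>p 1\<bar>"
  have bound: "\<bar>p t\<bar> \<le> B" if "t \<in> {0..1}" for t
  proof -
    have "p 0 \<le> p t" using that by (intro subgradient_mono[of f 0 p t] sub) auto
    moreover have "p t \<le> p 1" using that by (intro subgradient_mono[of f t p 1] sub) auto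
    ultimately show ?thesis unfolding B_def by linarith
  qed
  have below: "f t - f s \<le> B * \<bar>t - s\<bar>" if "s \<in> {0..1}" "t \<in> {0..1}" for s t
  proof -
    have "- (p t * (s - t)) \<le> \<bar>p t\<bar> * \<bar>t - s\<bar>"
      by (metis abs_ge_minus_self abs_minus_commute abs_mult)
    also have "\<dots> \<le> B * \<bar>t - s\<bar>" by (intro mult_right_mono bound that) auto
    finally show ?thesis using sub[OF that] by linarith
  qed
  have "B-lipschitz_on {0..1} f"
  proof (rule lipschitz_onI)
    fix s t :: real assume "s \<in> {0..1}" "t \<in> {0..1}"
    then show "dist (f s) (f t) \<le> B * dist s t"
      using below[of s t] below[of t s] by (simp add: dist_real_def abs_minus_commute)
  qed (simp add: B_def)
  then show ?thesis by (rule lipschitz_on_continuous_on)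
qed

text \<open>
  If \<open>f\<close> and \<open>g\<close> were differentiable, the hypotheses would say that they have the same logarithmic
  derivative. In general only an inequality is obtained directly; applied to the reversed interval
  it gives equality.
\<close>
lemma quotient_mono_if_proportional_subgradients:
  fixes f g p :: "real \<Rightarrow> real"
  assumes fpos: "\<And>t. t \<in> {0..1} \<Longrightarrow> 0 < f t"
    and gpos: "\<And>t. t \<in> {0..1} \<Longrightarrow> 0 < g t"
    and fsub: "\<And>s t. s \<in> {0..1} \<Longrightarrow> t \<in> {0..1} \<Longrightarrow> f t + p t * (s - t) \<le> f s"
    and gsub: "\<And>s t. s \<in> {0..1} \<Longrightarrow> t \<in> {0..1} \<Longrightarrow> g t + (g t / f t * p t) * (s - t) \<le> g s"
  shows "g 0 / f 0 \<le> g 1 / f 1"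
proof -
  have fcont: "continuous_on {0..1} f"
    using fsub by (rule continuous_on_if_subgradient)
  have gcont: "continuous_on {0..1} g"
    using gsub by (rule continuous_on_if_subgradient)
  obtain a where a: "a \<in> {0..1}" "\<And>t. t \<in> {0..1} \<Longrightarrow> f a \<le> f t"
    using continuous_attains_inf[OF _ _ fcont] by auto
  obtain b where b: "b \<in> {0..1}" "\<And>t. t \<in> {0..1} \<Longrightarrow> g t \<le> g b"
    using continuous_attains_sup[OF _ _ gcont] by auto
  define C where "C = g b / (f a * f a)"
  show ?thesis
  proof (rule nondecreasing_if_increments_second_order[where p = "\<lambda>t. C * p t"])
    fix s t :: real assume st: "0 \<le> t" "t \<le> s" "s \<le> 1"
    then have s: "s \<in> {0..1}" and t: "t \<in> {0..1}" by auto
    have ft: "0 < f t" and fs: "0 < f s" using fpos s t by auto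
    have pmono: "p t \<le> p s"
      using fsub[OF s t] fsub[OF t s] st(2) by (rule subgradient_mono)
    \<comment> \<open>The subgradient of \<open>f\<close> is taken at \<open>s\<close> but that of \<open>g\<close> at \<open>t\<close>: this makes the first-order
      terms combine to the difference \<open>p s - p t\<close>.\<close>
    have "g t * f s \<le> g t * (f t + p s * (s - t))"
      using fsub[OF t s] gpos[OF t] by (intro mult_left_mono) (auto simp: algebra_simps)
    moreover have "(g t + g t / f t * p t * (s - t)) * f t \<le> g s * f t"
      using gsub[OF s t] ft by (intro mult_right_mono) auto
    moreover have "(g t + g t / f t * p t * (s - t)) * f t = g t * f t + g t * p t * (s - t)"
      using ft by (simp add: field_simps)
    ultimately have cross: "g s * f t - g t * f s \<ge> - (g t * ((s - t) * (p s - p t)))"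
      by (simp add: algebra_simps)
    have "g t / (f s * f t) \<le> C"
      unfolding C_def using a b s t ft fs fpos[OF a(1)] gpos[OF b(1)] gpos[OF t]
      by (intro frac_le mult_mono) (auto simp: less_imp_le[OF ft] less_imp_le[OF fs] less_imp_le)
    then have "g t / (f s * f t) * ((s - t) * (p s - p t)) \<le> C * ((s - t) * (p s - p t))"
      using st pmono by (intro mult_right_mono) auto
    moreover have "g s / f s - g t / f t = (g s * f t - g t * f s) / (f s * f t)"
      using ft fs by (simp add: field_simps)
    moreover have "(g s * f t - g t * f s) / (f s * f t)
        \<ge> - (g t * ((s - t) * (p s - p t))) / (f s * f t)"
      using cross ft fs by (intro divide_right_mono) auto
    moreover have "- (g t * ((s - t) * (p s - p t))) / (f s * f t)
        = - (g t / (f s * f t) * ((s - t) * (p s - p t)))" by simp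
    ultimately have "g s / f s - g t / f t \<ge> - (C * ((s - t) * (p s - p t)))" by linarith
    then show "g s / f s - g t / f t \<ge> - ((s - t) * (C * p s - C * p t))"
      by (simp add: algebra_simps)
  qed
qed

section \<open>Gauge functions of convex bodies\<close>

lemma gauge_fun_le: "gauge_fun C (t *\<^sub>R k) \<le> t" if "0 \<le> t" "k \<in> C"
  unfolding gauge_fun_def
proof (rule cInf_lower)
  show "t \<in> {u. 0 \<le> u \<and> t *\<^sub>R k \<in> (*\<^sub>R) u ` C}"
    using that by (intro CollectI conjI imageI)
  show "bdd_below {u. 0 \<le> u \<and> t *\<^sub>R k \<in> (*\<^sub>R) u ` C}"
    by (rule bdd_belowI[where m = 0]) (drule CollectD, erule conjunct1)
qed

lemma gauge_fun_zero:
  assumes "C \<in> bodies0" shows "gauge_fun C 0 = 0"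
proof -
  have "0 \<in> C" using assms interior_subset by (auto simp: bodies0_def)
  then have "0 \<in> (*\<^sub>R) 0 ` C" by force
  then show ?thesis unfolding gauge_fun_def
    by (intro cInf_eq_minimum) (simp, drule CollectD, erule conjunct1)
qed

text \<open>
  Compactness makes the infimum in the gauge a minimum. Boundedness keeps the admissible factors
  away from \<open>0\<close>, where \<open>x /\<^sub>R t\<close> would fail to be continuous in \<open>t\<close>.
\<close>
lemma gauge_fun_attained:
  assumes C: "C \<in> bodies0" and x: "x \<noteq> 0"
  shows "0 < gauge_fun C x" and "x /\<^sub>R gauge_fun C x \<in> C"
proof -
  define T where "T = {t. 0 \<le> t \<and> x \<in> (*\<^sub>R) t ` C}"
  from C have "compact C" by (simp add: bodies0_def)
  then have "bounded C" by (rule compact_imp_bounded)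
  then obtain R where R: "0 < R" "\<And>y. y \<in> C \<Longrightarrow> norm y \<le> R"
    unfolding bounded_pos by blast
  define m where "m = norm x / R"
  have m: "0 < m" using R x by (simp add: m_def)
  have T: "T = {t \<in> {m..}. x /\<^sub>R t \<in> C}"
  proof (intro set_eqI iffI)
    fix t assume "t \<in> T"
    then obtain k where k: "0 \<le> t" "k \<in> C" "x = t *\<^sub>R k" by (auto simp: T_def)
    then have "norm x \<le> t * R" using R(2)[of k] by (simp add: mult_left_mono)
    then have "m \<le> t" using R(1) by (simp add: m_def divide_le_eq)
    moreover from this have "x /\<^sub>R t = k" using k m by simp
    ultimately show "t \<in> {t \<in> {m..}. x /\<^sub>R t \<in> C}" using k by simp
  next
    fix t assume "t \<in> {t \<in> {m..}. x /\<^sub>R t \<in> C}"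
    then have t: "0 < t" "x /\<^sub>R t \<in> C" using m by auto
    then have "x = t *\<^sub>R (x /\<^sub>R t)" by simp
    then show "t \<in> T"
      unfolding T_def using t by (intro CollectI conjI image_eqI[of _ _ "x /\<^sub>R t"]) auto
  qed
  have "continuous_on {m..} (\<lambda>t. x /\<^sub>R t)" using m by (intro continuous_intros) auto
  then have "closed ({m..} \<inter> (\<lambda>t. x /\<^sub>R t) -` C)"
    using compact_imp_closed[OF \<open>compact C\<close>]
    by (rule continuous_closed_preimage[OF _ closed_atLeast])
  moreover have "{m..} \<inter> (\<lambda>t. x /\<^sub>R t) -` C = T" unfolding T by auto
  ultimately have "closed T" by simp
  moreover have "T \<noteq> {}"
  proof -
    from C obtain e where e: "0 < e" "cball 0 e \<subseteq> C" by (auto simp: bodies0_def mem_interior_cball)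
    have "(e / norm x) *\<^sub>R x \<in> C" using e x by (intro subsetD[OF e(2)]) auto
    moreover have "x = (norm x / e) *\<^sub>R ((e / norm x) *\<^sub>R x)" using e x by simp
    ultimately have "x \<in> (*\<^sub>R) (norm x / e) ` C" by (rule rev_image_eqI)
    moreover have "0 \<le> norm x / e" using e by simp
    ultimately have "norm x / e \<in> T" unfolding T_def by simp
    then show ?thesis by auto
  qed
  moreover have "bdd_below T" unfolding T_def
    by (rule bdd_belowI[where m = 0]) (drule CollectD, erule conjunct1)
  ultimately have "Inf T \<in> T" by (intro closed_contains_Inf)
  moreover have "Inf T = gauge_fun C x" by (simp add: T_def gauge_fun_def)
  ultimately show "0 < gauge_fun C x" "x /\<^sub>R gauge_fun C x \<in> C" using m by (auto simp: T)
qed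

lemma gauge_fun_scale:
  assumes C: "C \<in> bodies0" and s: "0 < s"
  shows "gauge_fun C (s *\<^sub>R x) = s * gauge_fun C x"
proof (cases "x = 0")
  case True then show ?thesis using gauge_fun_zero[OF C] by simp
next
  case False
  have le: "gauge_fun C (u *\<^sub>R y) \<le> u * gauge_fun C y" if "0 < u" "y \<noteq> 0" for u y
  proof -
    note y = gauge_fun_attained[OF C that(2)]
    have "gauge_fun C ((u * gauge_fun C y) *\<^sub>R (y /\<^sub>R gauge_fun C y)) \<le> u * gauge_fun C y"
      using that y by (intro gauge_fun_le) auto
    moreover have "(u * gauge_fun C y) *\<^sub>R (y /\<^sub>R gauge_fun C y) = u *\<^sub>R y"
      using y(1) by simp
    ultimately show ?thesis by metis
  qed
  show ?thesis
    using le[OF s False] le[of "inverse s" "s *\<^sub>R x"] s False by (simp add: field_simps)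
qed

lemma gauge_fun_le_one_iff:
  assumes C: "C \<in> bodies0"
  shows "gauge_fun C x \<le> 1 \<longleftrightarrow> x \<in> C"
proof
  assume le: "gauge_fun C x \<le> 1"
  have "0 \<in> C" "convex C" using C interior_subset by (auto simp: bodies0_def)
  show "x \<in> C"
  proof (cases "x = 0")
    case False
    note x = gauge_fun_attained[OF C False]
    have "(1 - gauge_fun C x) *\<^sub>R 0 + gauge_fun C x *\<^sub>R (x /\<^sub>R gauge_fun C x) \<in> C"
      using \<open>0 \<in> C\<close> \<open>convex C\<close> le x by (intro convexD) auto
    then show ?thesis using x(1) by simp
  qed (simp add: \<open>0 \<in> C\<close>)
next
  assume "x \<in> C"
  then show "gauge_fun C x \<le> 1" using gauge_fun_le[of 1 x C] by simp
qed

section \<open>Supporting hyperplanes as normalised subgradients of the gauge\<close>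

text \<open>
  Since the origin is interior to \<open>C\<close>, a supporting hyperplane has a positive offset for its
  outward normal \<open>a\<close>; as it passes through a positive multiple of \<open>x\<close>, this gives \<open>a \<bullet> x > 0\<close> and
  the normal can be rescaled. Testing the halfspace on the boundary points \<open>y / gauge_fun C y\<close>
  turns containment of \<open>C\<close> into the homogeneous inequality for all \<open>y\<close>.
\<close>
lemma supports_at_gauge_iff:
  fixes C :: "(real^'n) set"
  assumes C: "C \<in> bodies0" and x: "x \<noteq> 0"
  shows "supports_at H C (x /\<^sub>R gauge_fun C x) \<longleftrightarrow>
    (\<exists>w. w \<bullet> x = 1 \<and> H = {y. w \<bullet> y = 1 / gauge_fun C x} \<and>
         (\<forall>y. gauge_fun C x * (w \<bullet> y) \<le> gauge_fun C y))"
    (is "?l \<longleftrightarrow> ?r")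
proof
  note gx = gauge_fun_attained[OF C x]
  assume ?l
  then obtain a0 b0 where a0: "a0 \<noteq> 0" "H = {y. a0 \<bullet> y = b0}"
      "C \<subseteq> {y. a0 \<bullet> y \<le> b0} \<or> C \<subseteq> {y. a0 \<bullet> y \<ge> b0}" "x /\<^sub>R gauge_fun C x \<in> H"
    unfolding supports_at_def by blast
  obtain a b where a: "a \<noteq> 0" and H: "H = {y. a \<bullet> y = b}" and sub: "C \<subseteq> {y. a \<bullet> y \<le> b}"
  proof (cases "C \<subseteq> {y. a0 \<bullet> y \<le> b0}")
    case True then show thesis using a0 that by blast
  next
    case False
    then show thesis using a0 by (intro that[of "- a0" "- b0"]) auto
  qed
  have "a \<bullet> (x /\<^sub>R gauge_fun C x) = b" using a0(4) unfolding H by blast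
  then have bx: "b = (a \<bullet> x) / gauge_fun C x" by (simp add: divide_inverse mult.commute)
  from C obtain e where e: "0 < e" "cball 0 e \<subseteq> C" by (auto simp: bodies0_def mem_interior_cball)
  \<comment> \<open>A point of \<open>C\<close> in the direction of the normal forces \<open>b\<close> to be positive.\<close>
  have "(e / norm a) *\<^sub>R a \<in> C" using e a by (intro subsetD[OF e(2)]) auto
  then have "a \<bullet> ((e / norm a) *\<^sub>R a) \<le> b" using sub by blast
  moreover have "0 < a \<bullet> ((e / norm a) *\<^sub>R a)" using e a by simp
  ultimately have "0 < b" by linarith
  then have ax: "0 < a \<bullet> x" using gx(1) by (simp add: bx zero_less_divide_iff)
  define w where "w = a /\<^sub>R (a \<bullet> x)"
  have w: "w \<bullet> y = (a \<bullet> y) / (a \<bullet> x)" for y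
    by (simp add: w_def divide_inverse mult.commute)
  have le: "gauge_fun C x * (w \<bullet> y) \<le> gauge_fun C y" for y
  proof (cases "y = 0")
    case False
    note gy = gauge_fun_attained[OF C False]
    have "a \<bullet> (y /\<^sub>R gauge_fun C y) \<le> b"
      using subsetD[OF sub gy(2)] by (rule CollectD)
    then have "(a \<bullet> y) / gauge_fun C y \<le> (a \<bullet> x) / gauge_fun C x"
      unfolding bx by (simp add: divide_inverse mult.commute)
    then show ?thesis unfolding w using gx(1) gy(1) ax by (simp add: field_simps)
  qed (simp add: gauge_fun_zero[OF C])
  have "a \<bullet> y = b \<longleftrightarrow> w \<bullet> y = 1 / gauge_fun C x" for y
    unfolding w bx using ax gx(1) by (auto simp: field_simps)
  then have "H = {y. w \<bullet> y = 1 / gauge_fun C x}" unfolding H by blast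
  moreover have "w \<bullet> x = 1" unfolding w using ax by simp
  ultimately show ?r using le by blast
next
  note gx = gauge_fun_attained[OF C x]
  assume ?r
  then obtain w where w: "w \<bullet> x = 1" "H = {y. w \<bullet> y = 1 / gauge_fun C x}"
    "\<And>y. gauge_fun C x * (w \<bullet> y) \<le> gauge_fun C y" by blast
  have "w \<bullet> y \<le> 1 / gauge_fun C x" if "y \<in> C" for y :: "real^'n"
  proof -
    have "gauge_fun C x * (w \<bullet> y) \<le> 1"
      using w(3)[of y] that gauge_fun_le_one_iff[OF C, of y] by linarith
    then show ?thesis using gx(1) by (simp add: field_simps)
  qed
  then have "C \<subseteq> {y. w \<bullet> y \<le> 1 / gauge_fun C x}" by blast
  moreover have "w \<noteq> 0" using w(1) by auto
  moreover have "x /\<^sub>R gauge_fun C x \<in> H"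
    unfolding w(2) by (simp add: w(1) divide_inverse)
  ultimately show ?l unfolding supports_at_def using w(2) gx(2) by blast
qed

text \<open>
  Translates of a hyperplane have proportional normals, and the normalisation against \<open>x\<close> removes
  the remaining factor.
\<close>
lemma affine_parallel_hyperplanes_iff:
  fixes w w' x :: "'a::euclidean_space"
  assumes w: "w \<bullet> x = 1" and w': "w' \<bullet> x = 1"
  shows "affine_parallel {y. w \<bullet> y = b} {y. w' \<bullet> y = b'} \<longleftrightarrow> w = w'"
proof
  assume "affine_parallel {y. w \<bullet> y = b} {y. w' \<bullet> y = b'}"
  then obtain c where c: "{y. w' \<bullet> y = b'} = (\<lambda>y. c + y) ` {y. w \<bullet> y = b}"
    unfolding affine_parallel_def by blast
  have shift: "w' \<bullet> (c + y) = b'" if "w \<bullet> y = b" for y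
    using c that by blast
  have "w' \<bullet> z = w \<bullet> z" for z
  proof -
    have "w' \<bullet> (c + (b *\<^sub>R x + (z - (w \<bullet> z) *\<^sub>R x))) = b'" "w' \<bullet> (c + b *\<^sub>R x) = b'"
      by (rule shift, simp add: inner_simps w)+
    then show ?thesis by (simp add: inner_simps w')
  qed
  then show "w = w'" using vector_eq_rdot by (metis inner_commute)
next
  assume eq: "w = w'"
  have "{y. w \<bullet> y = b'} = (\<lambda>y. (b' - b) *\<^sub>R x + y) ` {y. w \<bullet> y = b}" (is "?A = ?B")
  proof (intro set_eqI iffI)
    fix y assume "y \<in> ?A"
    then show "y \<in> ?B" by (intro image_eqI[of _ _ "y - (b' - b) *\<^sub>R x"]) (auto simp: inner_simps w)
  qed (auto simp: inner_simps w)
  then show "affine_parallel {y. w \<bullet> y = b} {y. w' \<bullet> y = b'}"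
    unfolding affine_parallel_def eq by blast
qed

lemma parallel_supports_iff_common_normal:
  assumes K: "K \<in> bodies0" and L: "L \<in> bodies0" and x: "x \<noteq> 0"
  shows "(\<exists>H H'. affine_parallel H H' \<and> supports_at H K (x /\<^sub>R gauge_fun K x) \<and>
              supports_at H' L (x /\<^sub>R gauge_fun L x))
    \<longleftrightarrow> (\<exists>w. w \<bullet> x = 1 \<and> (\<forall>y. gauge_fun K x * (w \<bullet> y) \<le> gauge_fun K y)
                      \<and> (\<forall>y. gauge_fun L x * (w \<bullet> y) \<le> gauge_fun L y))" (is "?l \<longleftrightarrow> ?r")
proof
  assume ?l
  then obtain H H' where par: "affine_parallel H H'"
    and H: "supports_at H K (x /\<^sub>R gauge_fun K x)"
    and H': "supports_at H' L (x /\<^sub>R gauge_fun L x)" by blast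
  from H obtain w where w: "w \<bullet> x = 1" "H = {y. w \<bullet> y = 1 / gauge_fun K x}"
      "\<forall>y. gauge_fun K x * (w \<bullet> y) \<le> gauge_fun K y"
    unfolding supports_at_gauge_iff[OF K x] by blast
  from H' obtain w' where w': "w' \<bullet> x = 1" "H' = {y. w' \<bullet> y = 1 / gauge_fun L x}"
      "\<forall>y. gauge_fun L x * (w' \<bullet> y) \<le> gauge_fun L y"
    unfolding supports_at_gauge_iff[OF L x] by blast
  have "w = w'"
    using par unfolding w(2) w'(2) affine_parallel_hyperplanes_iff[OF w(1) w'(1)] .
  with w w' show ?r by blast
next
  assume ?r
  then obtain w where w: "w \<bullet> x = 1" "\<forall>y. gauge_fun K x * (w \<bullet> y) \<le> gauge_fun K y"
      "\<forall>y. gauge_fun L x * (w \<bullet> y) \<le> gauge_fun L y" by blast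
  show ?l
  proof (intro exI conjI)
    show "affine_parallel {y. w \<bullet> y = 1 / gauge_fun K x} {y. w \<bullet> y = 1 / gauge_fun L x}"
      unfolding affine_parallel_hyperplanes_iff[OF w(1) w(1)] by (rule refl)
    show "supports_at {y. w \<bullet> y = 1 / gauge_fun K x} K (x /\<^sub>R gauge_fun K x)"
      unfolding supports_at_gauge_iff[OF K x] using w by blast
    show "supports_at {y. w \<bullet> y = 1 / gauge_fun L x} L (x /\<^sub>R gauge_fun L x)"
      unfolding supports_at_gauge_iff[OF L x] using w by blast
  qed
qed

text \<open>
  The point \<open>x / gauge_fun C x\<close> is not interior to \<open>C\<close>: otherwise it could be moved outwards
  along its ray, to a point of \<open>C\<close> with gauge larger than \<open>1\<close>. So the supporting hyperplane
  theorem applies to it.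
\<close>
lemma support_exists:
  assumes C: "C \<in> bodies0" and x: "x \<noteq> 0"
  shows "\<exists>w. w \<bullet> x = 1 \<and> (\<forall>y. gauge_fun C x * (w \<bullet> y) \<le> gauge_fun C y)"
proof -
  note gx = gauge_fun_attained[OF C x]
  define z where "z = x /\<^sub>R gauge_fun C x"
  have z: "gauge_fun C z = 1" unfolding z_def using gauge_fun_scale[OF C] gx(1) by simp
  have "z \<notin> interior C"
  proof
    assume "z \<in> interior C"
    then obtain e where e: "0 < e" "cball z e \<subseteq> C" by (auto simp: mem_interior_cball)
    have z0: "z \<noteq> 0" using x gx(1) by (simp add: z_def)
    define s where "s = 1 + e / norm z"
    have s: "1 < s" using e z0 by (simp add: s_def)
    have "s *\<^sub>R z \<in> C"
      using e z0 by (intro subsetD[OF e(2)]) (simp add: s_def dist_norm algebra_simps)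
    then have "s * gauge_fun C z \<le> 1"
      using gauge_fun_le_one_iff[OF C, of "s *\<^sub>R z"] gauge_fun_scale[OF C, of s z] s by simp
    then show False using z s by simp
  qed
  moreover have "interior C \<noteq> {}" "convex C" using C by (auto simp: bodies0_def)
  ultimately have "z \<notin> rel_interior C" using rel_interior_nonempty_interior by blast
  moreover have "z \<in> C" using gx(2) by (simp add: z_def)
  ultimately obtain a where a: "a \<noteq> 0" "\<And>y. y \<in> C \<Longrightarrow> a \<bullet> z \<le> a \<bullet> y"
    using supporting_hyperplane_rel_boundary[OF \<open>convex C\<close>, of z] by metis
  then have "supports_at {y. a \<bullet> y = a \<bullet> z} C z"
    unfolding supports_at_def using \<open>z \<in> C\<close> by blast
  then show ?thesis unfolding z_def supports_at_gauge_iff[OF C x] by blast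
qed

text \<open>
  A body is the unit ball of its gauge, and by homogeneity the gauge is determined by its unit ball.
\<close>
lemma dilates_iff_gauges_proportional:
  assumes K: "K \<in> bodies0" and L: "L \<in> bodies0"
  shows "dilates K L \<longleftrightarrow> (\<exists>c>0. \<forall>x. gauge_fun L x = c * gauge_fun K x)"
proof
  assume "dilates K L"
  then obtain t where t: "0 < t" "L = (*\<^sub>R) t ` K" unfolding dilates_def by blast
  have mem: "y \<in> L \<longleftrightarrow> y /\<^sub>R t \<in> K" for y
  proof
    assume "y /\<^sub>R t \<in> K"
    moreover have "y = t *\<^sub>R (y /\<^sub>R t)" using t(1) by simp
    ultimately show "y \<in> L" unfolding t(2) by (rule rev_image_eqI)
  qed (use t in auto)
  have iff: "gauge_fun L y \<le> 1 \<longleftrightarrow> inverse t * gauge_fun K y \<le> 1" for y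
    using gauge_fun_le_one_iff[OF L, of y] gauge_fun_le_one_iff[OF K, of "y /\<^sub>R t"] mem[of y]
      gauge_fun_scale[OF K, of "inverse t" y] t(1) by simp
  have "gauge_fun L x = inverse t * gauge_fun K x" for x
  proof (cases "x = 0")
    case False
    note k = gauge_fun_attained(1)[OF K False] and l = gauge_fun_attained(1)[OF L False]
    have "s * gauge_fun L x \<le> 1 \<longleftrightarrow> s * (inverse t * gauge_fun K x) \<le> 1" if "0 < s" for s
      using iff[of "s *\<^sub>R x"] that gauge_fun_scale[OF K that] gauge_fun_scale[OF L that]
      by (simp add: mult_ac)
    \<comment> \<open>Scaling \<open>x\<close> onto each of the two unit spheres gives one inequality each.\<close>
    from this[of "inverse (gauge_fun L x)"] this[of "inverse (inverse t * gauge_fun K x)"]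
    show ?thesis using k l t(1) by (simp add: field_simps)
  qed (simp add: gauge_fun_zero K L)
  then show "\<exists>c>0. \<forall>x. gauge_fun L x = c * gauge_fun K x" using t by (intro exI[of _ "inverse t"]) auto
next
  assume "\<exists>c>0. \<forall>x. gauge_fun L x = c * gauge_fun K x"
  then obtain c where c: "0 < c" "\<And>x. gauge_fun L x = c * gauge_fun K x" by blast
  have mem: "x \<in> L \<longleftrightarrow> c *\<^sub>R x \<in> K" for x
    using gauge_fun_le_one_iff[OF L, of x] gauge_fun_le_one_iff[OF K, of "c *\<^sub>R x"] c
      gauge_fun_scale[OF K, of c x] by simp
  then have "L = (*\<^sub>R) (inverse c) ` K"
  proof (intro set_eqI iffI)
    fix x assume "x \<in> L"
    then have "c *\<^sub>R x \<in> K" by (simp add: mem)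
    then show "x \<in> (*\<^sub>R) (inverse c) ` K" using c(1) by (rule_tac rev_image_eqI) auto
  qed (use c(1) in \<open>auto simp: mem\<close>)
  then show "dilates K L" unfolding dilates_def using c(1) by (intro exI[of _ "inverse c"]) auto
qed

section \<open>Common normals force proportional gauges\<close>

text \<open>
  Along the segment, \<open>f (z t) * (w (z t) \<bullet> (y - x))\<close> is a subderivative of the gauge \<open>f\<close> of \<open>K\<close>,
  and the same formula with the gauge of \<open>L\<close> differs from it only by the quotient of the gauges;
  this is the one-variable situation above.
\<close>
lemma gauge_quotient_segment_le:
  assumes K: "K \<in> bodies0" and L: "L \<in> bodies0"
    and normals: "\<And>x. x \<noteq> 0 \<Longrightarrow> \<exists>w. w \<bullet> x = 1 \<and> (\<forall>y. gauge_fun K x * (w \<bullet> y) \<le> gauge_fun K y)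
                      \<and> (\<forall>y. gauge_fun L x * (w \<bullet> y) \<le> gauge_fun L y)"
    and seg: "0 \<notin> closed_segment x y"
  shows "gauge_fun L x / gauge_fun K x \<le> gauge_fun L y / gauge_fun K y"
proof -
  define z where "z t = x + t *\<^sub>R (y - x)" for t
  have z0: "z t \<noteq> 0" if "t \<in> {0..1}" for t
  proof -
    have "z t = (1 - t) *\<^sub>R x + t *\<^sub>R y" by (simp add: z_def algebra_simps)
    then have "z t \<in> closed_segment x y" using that by (auto simp: closed_segment_def)
    then show ?thesis using seg by auto
  qed
  have zdiff: "z s = z t + (s - t) *\<^sub>R (y - x)" for s t by (simp add: z_def algebra_simps)
  obtain w where w: "\<And>x. x \<noteq> 0 \<Longrightarrow> w x \<bullet> x = 1"
      "\<And>x y. x \<noteq> 0 \<Longrightarrow> gauge_fun K x * (w x \<bullet> y) \<le> gauge_fun K y"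
      "\<And>x y. x \<noteq> 0 \<Longrightarrow> gauge_fun L x * (w x \<bullet> y) \<le> gauge_fun L y"
    using normals by metis
  have wz: "w (z t) \<bullet> z s = 1 + (w (z t) \<bullet> (y - x)) * (s - t)" if "t \<in> {0..1}" for s t
    unfolding zdiff[of s t] inner_add_right inner_scaleR_right w(1)[OF z0[OF that]] by simp
  have "gauge_fun L (z 0) / gauge_fun K (z 0) \<le> gauge_fun L (z 1) / gauge_fun K (z 1)"
  proof (rule quotient_mono_if_proportional_subgradients
      [where p = "\<lambda>t. gauge_fun K (z t) * (w (z t) \<bullet> (y - x))"])
    fix s t :: real assume s: "s \<in> {0..1}" and t: "t \<in> {0..1}"
    show "gauge_fun K (z t) + gauge_fun K (z t) * (w (z t) \<bullet> (y - x)) * (s - t) \<le> gauge_fun K (z s)"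
      using w(2)[OF z0[OF t], of "z s"] by (simp add: wz[OF t] algebra_simps)
    have "gauge_fun K (z t) \<noteq> 0" using gauge_fun_attained(1)[OF K z0[OF t]] by simp
    then show "gauge_fun L (z t) + gauge_fun L (z t) / gauge_fun K (z t)
        * (gauge_fun K (z t) * (w (z t) \<bullet> (y - x))) * (s - t) \<le> gauge_fun L (z s)"
      using w(3)[OF z0[OF t], of "z s"] by (simp add: wz[OF t] algebra_simps)
  qed (use gauge_fun_attained(1) K L z0 in auto)
  then show ?thesis by (simp add: z_def)
qed

text \<open>
  A ball around \<open>a\<close> of radius \<open>norm a\<close> is convex and misses the origin, so the previous lemma,
  applied in both directions, makes the quotient of the gauges locally constant. The dimension
  enters through the connectedness of the punctured space: on a line, the two half-lines could
  carry different constants.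
\<close>
lemma gauges_proportional_if_common_normals:
  fixes K L :: "(real^'n) set"
  assumes K: "K \<in> bodies0" and L: "L \<in> bodies0"
    and normals: "\<And>x. x \<noteq> 0 \<Longrightarrow> \<exists>w. w \<bullet> x = 1 \<and> (\<forall>y. gauge_fun K x * (w \<bullet> y) \<le> gauge_fun K y)
                      \<and> (\<forall>y. gauge_fun L x * (w \<bullet> y) \<le> gauge_fun L y)"
    and dim: "2 \<le> CARD('n)"
  shows "\<exists>c>0. \<forall>x. gauge_fun L x = c * gauge_fun K x"
proof -
  define r where "r x = gauge_fun L x / gauge_fun K x" for x
  have "r constant_on - {0}"
  proof (rule locally_constant_imp_constant)
    show "connected (- {0 :: real^'n})" using dim by (intro connected_punctured_universe) simp
    fix a :: "real^'n" assume "a \<in> - {0}"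
    then have a: "0 < norm a" by simp
    have "r x = r a" if "x \<in> ball a (norm a)" for x
    proof -
      have "closed_segment a x \<subseteq> ball a (norm a)"
        using a that by (intro closed_segment_subset) auto
      moreover have "0 \<notin> ball a (norm a)" by simp
      ultimately have "0 \<notin> closed_segment a x" by blast
      then show ?thesis
        using gauge_quotient_segment_le[OF K L normals, of a x]
          gauge_quotient_segment_le[OF K L normals, of x a]
        by (simp add: r_def closed_segment_commute)
    qed
    moreover have "openin (top_of_set (- {0})) (- {0} \<inter> ball a (norm a))"
      by (rule openin_open_Int[OF open_ball])
    moreover have "a \<in> - {0} \<inter> ball a (norm a)" using a by simp
    ultimately show "\<exists>T. openin (top_of_set (- {0})) T \<and> a \<in> T \<and> (\<forall>x\<in>T. r x = r a)"
      by blast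
  qed
  then obtain c where c: "\<And>x. x \<noteq> 0 \<Longrightarrow> r x = c" by (auto simp: constant_on_def)
  have pos: "0 < r x" if "x \<noteq> 0" for x
    using gauge_fun_attained(1)[OF K that] gauge_fun_attained(1)[OF L that] by (simp add: r_def)
  have "gauge_fun L x = c * gauge_fun K x" for x
  proof (cases "x = 0")
    case False
    then show ?thesis
      using c[OF False] gauge_fun_attained(1)[OF K False] by (simp add: r_def field_simps)
  qed (simp add: gauge_fun_zero K L)
  moreover have "0 < c" using pos[of "axis undefined 1"] c[of "axis undefined 1"] by simp
  ultimately show ?thesis by blast
qed

section \<open>The characterization\<close>

text \<open>
  On a line every \<open>y\<close> is a multiple \<open>s *\<^sub>R x\<close>, and the normalised normal at \<open>x\<close> merely reads off \<open>s\<close>.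
  It does not depend on \<open>C\<close>, so it serves any two bodies simultaneously.
\<close>
lemma support_on_line:
  fixes C :: "(real^'n) set"
  assumes C: "C \<in> bodies0" and x: "x \<noteq> 0" and dim: "CARD('n) = 1"
  shows "gauge_fun C x * ((x /\<^sub>R (x \<bullet> x)) \<bullet> y) \<le> gauge_fun C y"
proof -
  have "dim {x} = 1" unfolding dim_singleton using x by (rule if_not_P)
  then have "dim {x} = DIM(real^'n)" unfolding DIM_cart dim by simp
  then have "span {x} = UNIV" unfolding dim_eq_full .
  then have "y \<in> range (\<lambda>k. k *\<^sub>R x)" unfolding span_singleton by simp
  then obtain s where y: "y = s *\<^sub>R x" by (rule rangeE)
  have eq: "(x /\<^sub>R (x \<bullet> x)) \<bullet> y = s" using x unfolding y by simp
  have gx: "0 < gauge_fun C x" by (rule gauge_fun_attained(1)[OF C x])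
  show ?thesis
  proof (cases "0 < s")
    case True
    then show ?thesis unfolding eq unfolding y gauge_fun_scale[OF C True] by simp
  next
    case False
    have "0 \<le> gauge_fun C y"
    proof (cases "y = 0")
      case True
      show ?thesis unfolding True gauge_fun_zero[OF C] by (rule order_refl)
    next
      case False
      show ?thesis by (rule less_imp_le[OF gauge_fun_attained(1)[OF C False]])
    qed
    moreover have "gauge_fun C x * s \<le> 0" using gx False by (simp add: mult_nonneg_nonpos)
    ultimately show ?thesis unfolding eq by linarith
  qed
qed

theorem theorem5p1:
  fixes K L :: "(real^'n) set"
  assumes "K \<in> bodies0" and "L \<in> bodies0"
  shows "(\<forall>x. x \<noteq> 0 \<longrightarrow>
            (\<exists>H H'. affine_parallel H H' \<and>
               supports_at H K (x /\<^sub>R gauge_fun K x) \<and>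
               supports_at H' L (x /\<^sub>R gauge_fun L x)))
     \<longleftrightarrow> (CARD('n) = 1 \<or> dilates K L)"
proof -
  define common_normal where "common_normal x w \<longleftrightarrow> w \<bullet> x = 1
      \<and> (\<forall>y. gauge_fun K x * (w \<bullet> y) \<le> gauge_fun K y)
      \<and> (\<forall>y. gauge_fun L x * (w \<bullet> y) \<le> gauge_fun L y)" for x w
  have iff: "(\<exists>H H'. affine_parallel H H' \<and> supports_at H K (x /\<^sub>R gauge_fun K x) \<and>
               supports_at H' L (x /\<^sub>R gauge_fun L x)) \<longleftrightarrow> (\<exists>w. common_normal x w)"
    if "x \<noteq> 0" for x
    unfolding common_normal_def
    by (rule parallel_supports_iff_common_normal[OF assms that])
  have "(\<forall>x. x \<noteq> 0 \<longrightarrow> (\<exists>w. common_normal x w)) \<longleftrightarrow> (CARD('n) = 1 \<or> dilates K L)"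
  proof (intro iffI)
    assume normals: "\<forall>x. x \<noteq> 0 \<longrightarrow> (\<exists>w. common_normal x w)"
    show "CARD('n) = 1 \<or> dilates K L"
    proof (cases "CARD('n) = 1")
      case False
      moreover have "0 < CARD('n)" by simp
      ultimately have "2 \<le> CARD('n)" by linarith
      with assms normals show ?thesis
        unfolding dilates_iff_gauges_proportional[OF assms] common_normal_def
        by (intro disjI2 gauges_proportional_if_common_normals) auto
    qed simp
  next
    assume "CARD('n) = 1 \<or> dilates K L"
    then show "\<forall>x. x \<noteq> 0 \<longrightarrow> (\<exists>w. common_normal x w)"
    proof
      assume dim: "CARD('n) = 1"
      have "common_normal x (x /\<^sub>R (x \<bullet> x))" if "x \<noteq> 0" for x
        using support_on_line[OF assms(1) that dim] support_on_line[OF assms(2) that dim] that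
        by (simp add: common_normal_def)
      then show ?thesis by blast
    next
      assume "dilates K L"
      then obtain c where c: "0 < c" "\<And>x. gauge_fun L x = c * gauge_fun K x"
        unfolding dilates_iff_gauges_proportional[OF assms] by blast
      show ?thesis
        using support_exists[OF assms(1)] c by (simp add: common_normal_def mult.assoc)
    qed
  qed
  then show ?thesis using iff by simp
qed

end
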